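(* Let $(X_\alpha,T_\alpha)$ be an odometer system with $\alpha=\langle\alpha_1,\alpha_2,\ldots\rangle$ such that every prime number divides infinitely many of the $\alpha_i$. If $p:X_\alpha\to\mathbb{Z}^+$ is a bounded function such that $S(x)=T_\alpha^{p(x)}(x)$ defines a minimal homeomorphism $S:X_\alpha\to X_\alpha$, then $p\equiv1$.
   Context: Odometers: let $\alpha=\langle\alpha_1,\alpha_2,\ldots\rangle$ be a sequence of integers with every $\alpha_i\ge 2$. $X_\alpha$ is the set of sequences $(x_1,x_2,\ldots)$ with $0\le x_i\le\alpha_i-1$, with the product topology. Addition on $X_\alpha$ is coordinatewise with carrying to the right: $(x_i)+(y_i)=(z_i)$ with $r_1=0$, $z_j=(x_j+y_j+r_j)\bmod\alpha_j$, and for $j\ge2$, $r_j=0$ if $x_{j-1}+y_{j-1}+r_{j-1}<\alpha_{j-1}$ and $r_j=1$ otherwise. The odometer is $T_\alpha(x)=x+(1,0,0,\ldots)$, a minimal homeomorphism of a Cantor space. A homeomorphism is minimal if all its orbits are dense. *)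

theory Defs
  imports "HOL-Analysis.Analysis" "HOL-Computational_Algebra.Primes"
begin

text \<open>
  Sequences are indexed from \<open>0\<close>, so \<open>\<alpha> 0\<close> and \<open>x 0\<close> are the first terms
  usually written \<open>\<alpha>\<close> and \<open>x\<close> with subscript \<open>1\<close>.
\<close>

definition odometer_space :: "(nat \<Rightarrow> nat) \<Rightarrow> (nat \<Rightarrow> nat) topology" where
  "odometer_space \<alpha> = product_topology (\<lambda>i. discrete_topology {..<\<alpha> i}) UNIV"

primrec odometer_carry :: "(nat \<Rightarrow> nat) \<Rightarrow> (nat \<Rightarrow> nat) \<Rightarrow> (nat \<Rightarrow> nat) \<Rightarrow> nat \<Rightarrow> nat" where
  "odometer_carry \<alpha> x y 0 = 0"
| "odometer_carry \<alpha> x y (Suc j) =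
    (if x j + y j + odometer_carry \<alpha> x y j < \<alpha> j then 0 else 1)"

definition odometer_add :: "(nat \<Rightarrow> nat) \<Rightarrow> (nat \<Rightarrow> nat) \<Rightarrow> (nat \<Rightarrow> nat) \<Rightarrow> nat \<Rightarrow> nat" where
  "odometer_add \<alpha> x y = (\<lambda>j. (x j + y j + odometer_carry \<alpha> x y j) mod \<alpha> j)"

definition odometer :: "(nat \<Rightarrow> nat) \<Rightarrow> (nat \<Rightarrow> nat) \<Rightarrow> nat \<Rightarrow> nat" where
  "odometer \<alpha> x = odometer_add \<alpha> x (\<lambda>j. if j = 0 then 1 else 0)"

text \<open>
  Integer iterates of a bijection \<open>f\<close> of the set \<open>A\<close>; values at points outside
  \<open>A\<close>, or for \<open>f\<close> not bijective on \<open>A\<close>, carry no meaning.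
\<close>

definition int_iterate :: "'a set \<Rightarrow> ('a \<Rightarrow> 'a) \<Rightarrow> int \<Rightarrow> 'a \<Rightarrow> 'a" where
  "int_iterate A f n =
    (if n \<ge> 0 then f ^^ nat n else inv_into A f ^^ nat (- n))"

definition minimal_homeomorphism :: "'a topology \<Rightarrow> ('a \<Rightarrow> 'a) \<Rightarrow> bool" where
  "minimal_homeomorphism X f \<longleftrightarrow>
    homeomorphic_map X X f \<and>
    (\<forall>x\<in>topspace X. X closure_of (range (\<lambda>n. int_iterate (topspace X) f n x)) = topspace X)"

end

theory Submission
  imports Defs "HOL-Number_Theory.Cong"
begin

text \<open>
  Write \<open>T\<close> for the odometer, \<open>S\<close> for the map \<open>x \<mapsto> (T ^^ p x) x\<close>, and let \<open>P n\<close> be the product of the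
  first \<open>n\<close> bases. Reading the first \<open>n\<close> digits as a mixed-radix numeral gives a residue modulo
  \<open>P n\<close> on which \<open>T\<close> acts as \<open>+1\<close> (\<open>residue_odometer\<close>); fibres of these residues are the
  basic cylinders.

  Once \<open>P m\<close> exceeds the bound of \<open>p\<close>, the residues of \<open>x\<close> and \<open>S x\<close> modulo \<open>P m\<close> determine
  \<open>p x\<close>. As \<open>S\<close> is continuous, \<open>p\<close> is therefore locally constant, and by compactness it
  depends only on the residue modulo a single \<open>N = P n\<close>. Hence on every finer level \<open>S\<close> induces
  a map of the residues, and the \<open>S\<close>-orbit of the zero sequence is recorded by a walk on the
  natural numbers whose step size is \<open>N\<close>-periodic. Minimality makes this walk visit every
  residue class modulo every \<open>P m\<close> with \<open>m \<ge> n\<close> (\<open>walk_hits_residue\<close>).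

  The rest is arithmetic (\<open>walk_unit_steps\<close>). Modulo \<open>N\<close> the walk is a single cycle through
  all \<open>N\<close> classes, so in one turn it advances by the sum of all step sizes, which is \<open>c N\<close> for
  some \<open>c\<close>. At the multiples of \<open>N\<close> it then visits only multiples of \<open>c N\<close>. If a prime \<open>q\<close>
  divided \<open>c\<close>, the walk would miss the class of \<open>N\<close> modulo \<open>N M\<close> for every multiple \<open>M\<close> of \<open>q\<close>;
  but some \<open>N M\<close> of this form is a \<open>P m\<close>, because \<open>q\<close> divides bases beyond the first \<open>n\<close>.
  So \<open>c = 1\<close>, and \<open>N\<close> positive step sizes with sum \<open>N\<close> are all \<open>1\<close>.
\<close>

section \<open>Walks with a periodic step size\<close>

primrec walk :: "(nat \<Rightarrow> nat) \<Rightarrow> nat \<Rightarrow> nat" where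
  "walk g 0 = 0"
| "walk g (Suc k) = walk g k + g (walk g k)"

lemma walk_eq_sum: "walk g k = (\<Sum>i<k. g (walk g i))"
  by (induction k) auto

text \<open>
  Two positions congruent modulo the period see the same step sizes from then on. The equation is
  the equality of the two increments, written without subtraction.
\<close>

lemma walk_parallel:
  assumes per: "\<And>a. g (a mod N) = g a"
    and "[walk g i = walk g j] (mod N)"
  shows "walk g (i + k) + walk g j = walk g (j + k) + walk g i"
proof -
  have "walk g (i + k) + walk g j = walk g (j + k) + walk g i
      \<and> [walk g (i + k) = walk g (j + k)] (mod N)"
  proof (induction k)
    case 0
    then show ?case using assms(2) by simp
  next
    case (Suc k)
    have "g (walk g (i + k)) = g (walk g (j + k))"
      using Suc per by (metis cong_def)
    with Suc show ?case by (auto intro: cong_add)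
  qed
  then show ?thesis ..
qed

lemma walk_cong:
  assumes "\<And>a. g (a mod N) = g a" and "[walk g i = walk g j] (mod N)"
  shows "[walk g (i + k) = walk g (j + k)] (mod N)"
proof -
  have "[walk g (i + k) + walk g j = walk g (j + k) + walk g j] (mod N)"
    unfolding walk_parallel[OF assms] by (rule cong_add[OF cong_refl assms(2)])
  then show ?thesis by (simp add: cong_add_rcancel_nat)
qed

lemma walk_return_add:
  assumes per: "\<And>a. g (a mod N) = g a" and "N dvd walk g d"
  shows "walk g (d + k) = walk g d + walk g k"
  using walk_parallel[of g N d 0 k] assms by (simp add: cong_0_iff)

lemma walk_return_mult:
  assumes per: "\<And>a. g (a mod N) = g a" and "N dvd walk g d"
  shows "walk g (j * d) = j * walk g d"
  by (induction j) (simp_all add: walk_return_add[OF assms])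

text \<open>
  Before its first return to \<open>0\<close> modulo \<open>N\<close> the walk cannot repeat a class, since a repetition at
  times \<open>i < j\<close> would bring the return forward by \<open>j - i\<close>. After it, the walk repeats itself modulo
  \<open>N\<close>. So one turn meets each class exactly once, and its length is the sum of all step sizes.
\<close>

lemma walk_first_return:
  assumes N: "N > 0" and per: "\<And>a. g (a mod N) = g a"
    and hit: "\<And>b. \<exists>k. [walk g k = b] (mod N)"
    and d: "d > 0" "N dvd walk g d"
    and least: "\<And>k. 0 < k \<Longrightarrow> k < d \<Longrightarrow> \<not> N dvd walk g k"
  shows "walk g d = (\<Sum>a<N. g a)"
    and "N dvd walk g k \<Longrightarrow> d dvd k"
proof -
  have reduce: "[walk g k = walk g (k mod d)] (mod N)" for k
  proof -
    have "walk g k = walk g ((k div d) * d + k mod d)" by simp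
    also have "\<dots> = (k div d) * walk g d + walk g (k mod d)"
      using walk_return_add[of g N "(k div d) * d" "k mod d"]
        walk_return_mult[of g N d "k div d"] per d(2) by simp
    finally show ?thesis using d(2) by (auto simp: cong_def mod_add_left_eq[symmetric])
  qed
  show "d dvd k" if "N dvd walk g k" for k
  proof (rule ccontr)
    assume "\<not> d dvd k"
    then have "0 < k mod d" "k mod d < d" using d(1) by (auto simp: dvd_eq_mod_eq_0)
    moreover have "N dvd walk g (k mod d)" using that reduce[of k] by (simp add: cong_dvd_iff)
    ultimately show False using least by blast
  qed
  have no_repeat: False if ij: "i < j" "j < d" and c: "[walk g i = walk g j] (mod N)" for i j
  proof -
    have "[walk g (i + (d - j)) = walk g (j + (d - j))] (mod N)" by (rule walk_cong[OF per c])
    then have "N dvd walk g (i + (d - j))" using ij d(2) by (simp add: cong_dvd_iff)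
    moreover have "\<not> N dvd walk g (i + (d - j))" using ij by (intro least) linarith+
    ultimately show False by contradiction
  qed
  have inj: "inj_on (\<lambda>k. walk g k mod N) {..<d}"
  proof (rule inj_onI)
    fix i j assume "i \<in> {..<d}" "j \<in> {..<d}" "walk g i mod N = walk g j mod N"
    then show "i = j" using no_repeat[of i j] no_repeat[of j i]
      by (cases i j rule: linorder_cases) (auto simp: cong_def)
  qed
  have img: "(\<lambda>k. walk g k mod N) ` {..<d} = {..<N}"
  proof
    show "{..<N} \<subseteq> (\<lambda>k. walk g k mod N) ` {..<d}"
    proof
      fix b assume b: "b \<in> {..<N}"
      obtain k where "[walk g k = b] (mod N)" using hit by blast
      then have "walk g (k mod d) mod N = b" using b reduce[of k] by (simp add: cong_def)
      then show "b \<in> (\<lambda>k. walk g k mod N) ` {..<d}" using d(1) by (intro image_eqI[of _ _ "k mod d"]) auto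
    qed
  qed (use N in auto)
  have "(\<Sum>a<N. g a) = (\<Sum>k<d. g (walk g k mod N))"
    by (subst img[symmetric], subst sum.reindex[OF inj]) simp
  also have "\<dots> = walk g d" by (simp add: per walk_eq_sum[of g d])
  finally show "walk g d = (\<Sum>a<N. g a)" ..
qed

text \<open>
  The arithmetic core. The class of \<open>N\<close> modulo \<open>N * M\<close> does double duty: for \<open>q = 2\<close> a visit
  to it takes place at a positive time and so shows that the walk returns to \<open>0\<close> modulo \<open>N\<close> at
  all; for a prime \<open>q\<close> dividing the number of windings per turn a visit to it is impossible.
\<close>

proposition walk_unit_steps:
  assumes N: "N > 0" and per: "\<And>a. g (a mod N) = g a" and pos: "\<And>a. g a > 0"
    and hit: "\<And>q. prime q \<Longrightarrow> \<exists>M. q dvd M \<and> (\<forall>b. \<exists>k. [walk g k = b] (mod N * M))"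
  shows "g a = 1"
proof -
  have hitN: "\<exists>k. [walk g k = b] (mod N)" for b
    using hit[OF two_is_prime_nat] by (meson cong_modulus_mult_nat)
  have "\<exists>k>0. N dvd walk g k"
  proof -
    obtain M k where M: "2 dvd M" "[walk g k = N] (mod N * M)"
      using hit[OF two_is_prime_nat] by blast
    have "N dvd walk g k" using cong_modulus_mult_nat[OF M(2)] by (simp add: cong_dvd_iff)
    moreover have "k \<noteq> 0"
    proof
      assume "k = 0"
      then have "N * M dvd N * 1" using M(2) by (simp add: cong_sym_eq[of 0] cong_0_iff)
      then have "M dvd 1" using N by (subst (asm) nat_mult_dvd_cancel_disj) simp
      with M(1) show False by simp
    qed
    ultimately show ?thesis by blast
  qed
  then obtain d where d: "d > 0 \<and> N dvd walk g d"
    and least: "\<And>k. k < d \<Longrightarrow> \<not> (k > 0 \<and> N dvd walk g k)"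
    using exists_least_iff[of "\<lambda>k. k > 0 \<and> N dvd walk g k"] by blast
  note first = walk_first_return[OF N per hitN, of d]
  have total: "walk g d = (\<Sum>a<N. g a)" using d least by (intro first) blast+
  obtain c where c: "walk g d = N * c" using d by blast
  have "c = 1"
  proof (rule ccontr)
    assume "c \<noteq> 1"
    then obtain q where q: "prime q" "q dvd c" using prime_factor_nat by blast
    obtain M k where M: "q dvd M" and k: "[walk g k = N] (mod N * M)"
      using hit[OF q(1)] by blast
    have "N dvd walk g k" using cong_modulus_mult_nat[OF k] by (simp add: cong_dvd_iff)
    then have "d dvd k" using d least by (intro first) blast+
    then obtain j where "k = j * d" by (metis dvd_div_mult_self)
    then have "walk g k = N * (j * c)" using walk_return_mult[of g N d j] per d c by simp
    then have "[N * (j * c) = N * 1] (mod N * M)" using k by simp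
    then have "[j * c = 1] (mod M)" using N by (simp add: cong_def mult_mod_right[symmetric])
    then have "[j * c = 1] (mod q)" using M by (rule cong_dvd_modulus_nat)
    then have "q dvd 1" using q(2) by (metis cong_dvd_iff dvd_mult)
    with q(1) show False by simp
  qed
  then have sum: "(\<Sum>a<N. g a) = (\<Sum>a<N. 1)" using total c by simp
  have "g b = 1" if "b < N" for b
  proof (rule ccontr)
    assume "g b \<noteq> 1"
    then have "(\<Sum>a<N. 1) < (\<Sum>a<N. g a)"
      using that pos by (intro sum_strict_mono_ex1) (auto simp: Suc_le_eq intro!: bexI[of _ b] le_neq_implies_less)
    with sum show False by simp
  qed
  from this[of "a mod N"] show ?thesis using per N by simp
qed


section \<open>Finite quotients of an odometer\<close>

locale odometer_system =
  fixes \<alpha> :: "nat \<Rightarrow> nat"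
  assumes base_ge_2: "\<And>i. \<alpha> i \<ge> 2"
begin

abbreviation "X \<equiv> topspace (odometer_space \<alpha>)"

definition modulus :: "nat \<Rightarrow> nat" where
  "modulus n = (\<Prod>i<n. \<alpha> i)"

text \<open>
  The value of the first \<open>n\<close> digits in mixed radix, least significant digit first.
\<close>

definition residue :: "nat \<Rightarrow> (nat \<Rightarrow> nat) \<Rightarrow> nat" where
  "residue n x = (\<Sum>i<n. x i * modulus i)"

lemma modulus_Suc: "modulus (Suc n) = modulus n * \<alpha> n"
  by (simp add: modulus_def)

lemma residue_Suc: "residue (Suc n) x = residue n x + x n * modulus n"
  by (simp add: residue_def)

lemma base_pos: "\<alpha> i > 0"
  using base_ge_2[of i] by simp

lemma modulus_pos: "modulus n > 0"
  by (simp add: modulus_def prod_pos base_pos)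

lemma less_modulus: "n < modulus n"
proof (induction n)
  case (Suc n)
  have "Suc n < modulus n * 2" using Suc by simp
  also have "\<dots> \<le> modulus (Suc n)" unfolding modulus_Suc by (rule mult_le_mono2[OF base_ge_2])
  finally show ?case .
qed (simp add: modulus_def)

lemma modulus_split: "m \<le> n \<Longrightarrow> modulus n = modulus m * (\<Prod>i=m..<n. \<alpha> i)"
  unfolding modulus_def
  by (metis atLeast0LessThan prod.atLeastLessThan_concat zero_le)

lemma in_X_iff: "x \<in> X \<longleftrightarrow> (\<forall>i. x i < \<alpha> i)"
  by (auto simp: odometer_space_def topspace_product_topology PiE_iff)

lemma zero_in_X: "(\<lambda>_. 0) \<in> X"
  by (simp add: in_X_iff base_pos)

lemma residue_zero: "residue n (\<lambda>_. 0) = 0"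
  by (simp add: residue_def)

lemma residue_less: "x \<in> X \<Longrightarrow> residue n x < modulus n"
proof (induction n)
  case (Suc n)
  have "residue (Suc n) x < modulus n + x n * modulus n"
    using Suc by (simp add: residue_Suc)
  also have "\<dots> = Suc (x n) * modulus n" by simp
  also have "\<dots> \<le> \<alpha> n * modulus n" using Suc.prems by (intro mult_le_mono1) (simp add: in_X_iff Suc_le_eq)
  finally show ?case by (simp add: modulus_Suc mult.commute)
qed (simp add: residue_def modulus_def)

lemma residue_mod:
  assumes "x \<in> X" "m \<le> n"
  shows "residue n x mod modulus m = residue m x"
  using assms(2)
proof (induction n rule: dec_induct)
  case base
  then show ?case using residue_less[OF assms(1)] by simp
next
  case (step n)
  have "modulus m dvd x n * modulus n" using modulus_split[OF step(1)] by simp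
  then show ?case using step by (auto simp: residue_Suc mod_add_right_eq[symmetric])
qed

lemma residue_eqD:
  assumes "x \<in> X" "y \<in> X" "residue n x = residue n y"
  shows "m \<le> n \<Longrightarrow> residue m x = residue m y" and "i < n \<Longrightarrow> x i = y i"
proof -
  show *: "residue m x = residue m y" if "m \<le> n" for m
    using assms residue_mod[OF _ that] by metis
  show "x i = y i" if "i < n"
    using *[of i] *[of "Suc i"] that modulus_pos[of i] by (simp add: residue_Suc)
qed

lemma residue_cong: "(\<And>i. i < n \<Longrightarrow> x i = y i) \<Longrightarrow> residue n x = residue n y"
  by (simp add: residue_def)

lemma odometer_in_X: "odometer \<alpha> x \<in> X"
  by (simp add: in_X_iff odometer_def odometer_add_def base_pos)

lemma odometer_power_in_X: "x \<in> X \<Longrightarrow> (odometer \<alpha> ^^ k) x \<in> X"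
  by (cases k) (auto simp: odometer_in_X)

text \<open>
  Carrying is exact bookkeeping: adding \<open>1\<close> to the numeral formed by the first \<open>n\<close> digits
  changes it as the odometer does, except for the carry that leaves position \<open>n - 1\<close>, which is
  worth a multiple of \<open>modulus n\<close>.
\<close>

lemma residue_odometer:
  assumes "x \<in> X"
  shows "residue n (odometer \<alpha> x) = (residue n x + 1) mod modulus n"
proof -
  define e where "e = (\<lambda>j::nat. if j = 0 then 1 else 0 :: nat)"
  define r where "r = odometer_carry \<alpha> x e"
  have r01: "r j \<le> 1" for j by (cases j) (auto simp: r_def)
  have digit: "x j + e j + r j = odometer \<alpha> x j + \<alpha> j * r (Suc j)" for j
  proof -
    have "x j + e j + r j < 2 * \<alpha> j"
      using assms base_ge_2[of j] r01[of j] by (auto simp: in_X_iff e_def r_def dest!: spec[of _ j])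
    then show ?thesis
      by (auto simp: odometer_def odometer_add_def r_def e_def[symmetric] mod_if)
  qed
  \<comment> \<open>Only positive lengths: the unit enters at digit \<open>0\<close> as a summand, not as an incoming carry,
    so the invariant fails for the empty numeral.\<close>
  have carry: "residue (Suc n) x + 1 = residue (Suc n) (odometer \<alpha> x) + modulus (Suc n) * r (Suc n)" for n
  proof (induction n)
    case 0
    then show ?case using digit[of 0] by (simp add: residue_def modulus_def r_def e_def)
  next
    case (Suc n)
    have "residue (Suc (Suc n)) x + 1 = residue (Suc n) (odometer \<alpha> x)
        + modulus (Suc n) * (x (Suc n) + r (Suc n))"
      using Suc by (subst residue_Suc) (simp add: algebra_simps)
    also have "x (Suc n) + r (Suc n) = odometer \<alpha> x (Suc n) + \<alpha> (Suc n) * r (Suc (Suc n))"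
      using digit[of "Suc n"] by (simp add: e_def)
    finally show ?case
      by (simp add: residue_Suc[of "Suc n"] modulus_Suc[of "Suc n"] algebra_simps)
  qed
  show ?thesis
  proof (cases n)
    case 0
    then show ?thesis by (simp add: residue_def modulus_def)
  next
    case (Suc m)
    then show ?thesis using carry[of m] residue_less[OF odometer_in_X, of n x] by simp
  qed
qed

lemma residue_odometer_power:
  assumes "x \<in> X"
  shows "residue n ((odometer \<alpha> ^^ k) x) = (residue n x + k) mod modulus n"
  by (induction k)
     (simp_all add: assms residue_less residue_odometer odometer_power_in_X mod_Suc_eq)

lemma residue_odometer_power_zero:
  "residue n ((odometer \<alpha> ^^ k) (\<lambda>_. 0)) = k mod modulus n"
  by (simp add: residue_odometer_power zero_in_X residue_zero)

lemma openin_cylinder: "openin (odometer_space \<alpha>) {y \<in> X. residue n y = a}"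
  unfolding odometer_space_def openin_product_topology_alt
proof (intro ballI)
  fix x assume "x \<in> {y \<in> topspace (product_topology (\<lambda>i. discrete_topology {..<\<alpha> i}) UNIV). residue n y = a}"
  then have x: "x \<in> X" "residue n x = a" by (simp_all add: odometer_space_def)
  define U where "U i = (if i < n then {x i} else {..<\<alpha> i})" for i
  have "{i. U i \<noteq> {..<\<alpha> i}} \<subseteq> {..<n}" by (auto simp: U_def split: if_splits)
  then have fin: "finite {i. U i \<noteq> {..<\<alpha> i}}" by (rule finite_subset) simp
  have sub: "U i \<subseteq> {..<\<alpha> i}" and mem: "x i \<in> U i" for i
    using x(1) by (auto simp: U_def in_X_iff)
  have "y \<in> X \<and> residue n y = a" if "\<And>i. y i \<in> U i" for y
  proof
    show "y \<in> X" using that sub by (fastforce simp: in_X_iff)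
    have "y i = x i" if "i < n" for i using \<open>\<And>i. y i \<in> U i\<close>[of i] that by (simp add: U_def)
    then show "residue n y = a" using x(2) residue_cong by metis
  qed
  then show "\<exists>U. finite {i \<in> UNIV. U i \<noteq> topspace (discrete_topology {..<\<alpha> i})} \<and>
      (\<forall>i\<in>UNIV. openin (discrete_topology {..<\<alpha> i}) (U i)) \<and> x \<in> Pi\<^sub>E UNIV U \<and>
      Pi\<^sub>E UNIV U \<subseteq> {y \<in> topspace (product_topology (\<lambda>i. discrete_topology {..<\<alpha> i}) UNIV). residue n y = a}"
    using fin sub mem by (intro exI[of _ U]) (auto simp: odometer_space_def PiE_iff)
qed

lemma openin_contains_cylinder:
  assumes "openin (odometer_space \<alpha>) V" "x \<in> V"
  obtains n where "\<And>y. y \<in> X \<Longrightarrow> residue n y = residue n x \<Longrightarrow> y \<in> V"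
proof -
  obtain U where fin: "finite {i. U i \<noteq> {..<\<alpha> i}}" and x: "x \<in> Pi\<^sub>E UNIV U" and sub: "Pi\<^sub>E UNIV U \<subseteq> V"
    using assms unfolding odometer_space_def openin_product_topology_alt by auto
  have xX: "x \<in> X" using openin_subset[OF assms(1)] assms(2) by blast
  obtain n where n: "{i. U i \<noteq> {..<\<alpha> i}} \<subseteq> {..<n}"
    using fin by (metis finite_nat_iff_bounded)
  show thesis
  proof (rule that[of n])
    fix y assume y: "y \<in> X" "residue n y = residue n x"
    have "y i \<in> U i" for i
    proof (cases "i < n")
      case True
      then show ?thesis using residue_eqD(2)[OF y(1) xX y(2)] x by auto
    next
      case False
      then have "U i = {..<\<alpha> i}" using n by auto
      then show ?thesis using y(1) by (simp add: in_X_iff)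
    qed
    then show "y \<in> V" using sub by auto
  qed
qed

lemma compact_space_odometer: "compact_space (odometer_space \<alpha>)"
  by (simp add: odometer_space_def compact_space_product_topology compact_space_discrete_topology)

text \<open>
  Cylinders are nested, so among finitely many of them that cover the space the finest level
  refines all; compactness provides the finite cover.
\<close>

lemma locally_constant_factors:
  assumes "\<And>x. x \<in> X \<Longrightarrow> \<exists>n. \<forall>y\<in>X. residue n y = residue n x \<longrightarrow> p y = p x"
  obtains n where "\<And>x y. x \<in> X \<Longrightarrow> y \<in> X \<Longrightarrow> residue n x = residue n y \<Longrightarrow> p x = p y"
proof -
  obtain l where l: "\<And>x y. x \<in> X \<Longrightarrow> y \<in> X \<Longrightarrow> residue (l x) y = residue (l x) x \<Longrightarrow> p y = p x"
    using assms by metis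
  define C where "C x = {y \<in> X. residue (l x) y = residue (l x) x}" for x
  have "\<exists>\<F>. finite \<F> \<and> \<F> \<subseteq> C ` X \<and> X \<subseteq> \<Union>\<F>"
    using compact_space_odometer unfolding compact_space_alt
    by (elim allE[of _ "C ` X"]) (auto simp: C_def openin_cylinder)
  then obtain F where F: "finite F" "F \<subseteq> X" "X \<subseteq> \<Union>(C ` F)"
    by (metis finite_subset_image)
  show thesis
  proof (rule that[of "Max (l ` F)"])
    fix x y assume xy: "x \<in> X" "y \<in> X" "residue (Max (l ` F)) x = residue (Max (l ` F)) y"
    then obtain z where z: "z \<in> F" "x \<in> C z" using F by blast
    have "l z \<le> Max (l ` F)" using F(1) z(1) by simp
    then have "residue (l z) x = residue (l z) y" by (rule residue_eqD(1)[OF xy])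
    then have "y \<in> C z" using z xy by (simp add: C_def)
    with z show "p x = p y" using l[of z] F(2) by (metis (mono_tags, lifting) C_def mem_Collect_eq subsetD)
  qed
qed

end


section \<open>Minimal bounded speedups\<close>

locale minimal_speedup = odometer_system +
  fixes p :: "(nat \<Rightarrow> nat) \<Rightarrow> nat"
  assumes bounded: "\<exists>B. \<forall>x \<in> X. p x \<le> B"
    and minimal: "minimal_homeomorphism (odometer_space \<alpha>) (\<lambda>x. (odometer \<alpha> ^^ p x) x)"
begin

definition speedup :: "(nat \<Rightarrow> nat) \<Rightarrow> nat \<Rightarrow> nat" where
  "speedup x = (odometer \<alpha> ^^ p x) x"

lemma speedup_homeomorphic: "homeomorphic_map (odometer_space \<alpha>) (odometer_space \<alpha>) speedup"
  using minimal unfolding minimal_homeomorphism_def speedup_def by blast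

lemma speedup_image: "speedup ` X = X"
  using homeomorphic_imp_surjective_map[OF speedup_homeomorphic] .

lemma speedup_dense:
  "x \<in> X \<Longrightarrow> odometer_space \<alpha> closure_of (range (\<lambda>n. int_iterate X speedup n x)) = X"
  using minimal unfolding minimal_homeomorphism_def speedup_def by blast

lemma residue_speedup: "x \<in> X \<Longrightarrow> residue n (speedup x) = (residue n x + p x) mod modulus n"
  by (simp add: speedup_def residue_odometer_power)

text \<open>
  Continuity of \<open>p\<close> comes from that of \<open>S\<close>: if \<open>y\<close> is close to \<open>x\<close>, then so is \<open>S y\<close> to
  \<open>S x\<close>, whence \<open>p y\<close> and \<open>p x\<close> are congruent modulo a number that exceeds the bound of \<open>p\<close>.
\<close>

lemma p_locally_constant:
  assumes x: "x \<in> X"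
  shows "\<exists>n. \<forall>y\<in>X. residue n y = residue n x \<longrightarrow> p y = p x"
proof -
  \<comment> \<open>The bound itself serves as the level, as \<open>B < modulus B\<close>.\<close>
  obtain B where B: "\<And>x. x \<in> X \<Longrightarrow> p x \<le> B" using bounded by blast
  define V where "V = {y \<in> X. residue B (speedup y) = residue B (speedup x)}"
  have "V = {y \<in> X. speedup y \<in> {z \<in> X. residue B z = residue B (speedup x)}}"
    using speedup_image by (auto simp: V_def)
  then have "openin (odometer_space \<alpha>) V"
    using openin_continuous_map_preimage[OF homeomorphic_imp_continuous_map[OF speedup_homeomorphic] openin_cylinder]
    by simp
  moreover have "x \<in> V" using x by (simp add: V_def)
  ultimately obtain n where n: "\<And>y. y \<in> X \<Longrightarrow> residue n y = residue n x \<Longrightarrow> y \<in> V"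
    by (rule openin_contains_cylinder) blast
  show ?thesis
  proof (intro exI[of _ "max n B"] ballI impI)
    fix y assume y: "y \<in> X" "residue (max n B) y = residue (max n B) x"
    have "residue n y = residue n x" "residue B y = residue B x"
      using residue_eqD(1)[OF y(1) x y(2)] by auto
    then have "(residue B x + p y) mod modulus B = (residue B x + p x) mod modulus B"
      using n[OF y(1)] x y(1) by (simp add: V_def residue_speedup)
    then have "[p y = p x] (mod modulus B)"
      using cong_add_lcancel_nat[of "residue B x"] unfolding cong_def by blast
    moreover have "p y < modulus B" "p x < modulus B"
      using B[OF x] B[OF y(1)] less_modulus[of B] by simp_all
    ultimately show "p y = p x" by (rule cong_less_modulus_unique_nat)
  qed
qed

text \<open>
  The values of \<open>p\<close> along the \<open>T\<close>-orbit of the zero sequence. This orbit meets every cylinder,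
  so it represents all residues by explicit points.
\<close>

definition step :: "nat \<Rightarrow> nat" where
  "step a = p ((odometer \<alpha> ^^ a) (\<lambda>_. 0))"

lemma speedup_power_zero: "(speedup ^^ k) (\<lambda>_. 0) = (odometer \<alpha> ^^ walk step k) (\<lambda>_. 0)"
proof (induction k)
  case (Suc k)
  have "walk step (Suc k) = step (walk step k) + walk step k" by simp
  then have "(odometer \<alpha> ^^ walk step (Suc k)) (\<lambda>_. 0)
      = (odometer \<alpha> ^^ step (walk step k)) ((odometer \<alpha> ^^ walk step k) (\<lambda>_. 0))"
    by (simp only: funpow_add o_apply)
  also have "\<dots> = speedup ((odometer \<alpha> ^^ walk step k) (\<lambda>_. 0))"
    by (simp only: speedup_def step_def)
  finally show ?case using Suc by simp
qed simp

lemma int_iterate_invariant: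
  assumes "A \<subseteq> X" "x \<in> A"
    and inv: "\<And>y. y \<in> X \<Longrightarrow> speedup y \<in> A \<longleftrightarrow> y \<in> A"
  shows "int_iterate X speedup n x \<in> A"
proof -
  have fwd: "(speedup ^^ k) x \<in> A" for k
    using assms by (induction k) auto
  have bwd: "(inv_into X speedup ^^ k) x \<in> A" for k
  proof (induction k)
    case (Suc k)
    let ?y = "(inv_into X speedup ^^ k) x"
    have y: "?y \<in> speedup ` X" using Suc assms(1) speedup_image by auto
    have "inv_into X speedup ?y \<in> X" "speedup (inv_into X speedup ?y) = ?y"
      by (rule inv_into_into[OF y], rule f_inv_into_f[OF y])
    then show ?case using Suc inv by (metis funpow.simps(2) o_apply)
  qed (use assms(2) in simp)
  show ?thesis using fwd bwd by (simp add: int_iterate_def)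
qed

text \<open>
  Minimality speaks of two-sided orbits, the walk only of forward ones. On the finitely many
  residues modulo \<open>modulus m\<close> the difference vanishes: \<open>S\<close> induces a surjection there, hence a
  permutation, so the set \<open>R\<close> of residues that the walk visits is invariant in both directions.
  Its preimage in the space then contains a whole dense orbit and so meets every cylinder.
\<close>

lemma walk_hits_residue:
  assumes n: "\<And>x y. x \<in> X \<Longrightarrow> y \<in> X \<Longrightarrow> residue n x = residue n y \<Longrightarrow> p x = p y"
    and "n \<le> m"
  shows "\<exists>k. [walk step k = b] (mod modulus m)"
proof -
  let ?L = "modulus m"
  define \<sigma> where "\<sigma> a = (a + step a) mod ?L" for a
  have p_step: "p x = step (residue m x)" if "x \<in> X" for x
  proof -
    have "residue m ((odometer \<alpha> ^^ residue m x) (\<lambda>_. 0)) = residue m x"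
      using residue_less[OF that] by (simp add: residue_odometer_power_zero)
    then have "residue n ((odometer \<alpha> ^^ residue m x) (\<lambda>_. 0)) = residue n x"
      using residue_eqD(1)[OF _ that _ \<open>n \<le> m\<close>] odometer_power_in_X zero_in_X by blast
    then show ?thesis unfolding step_def
      by (metis n that odometer_power_in_X zero_in_X)
  qed
  have factor: "residue m (speedup x) = \<sigma> (residue m x)" if "x \<in> X" for x
    using residue_speedup[OF that] p_step[OF that] by (simp add: \<sigma>_def)
  define R where "R = range (\<lambda>k. walk step k mod ?L)"
  have res_walk: "walk step k mod ?L = residue m ((speedup ^^ k) (\<lambda>_. 0))" for k
    by (simp add: speedup_power_zero residue_odometer_power_zero)
  have pow_X: "(speedup ^^ k) (\<lambda>_. 0) \<in> X" for k
    by (simp add: speedup_power_zero odometer_power_in_X zero_in_X)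
  have R_sub: "R \<subseteq> {..<?L}" using modulus_pos by (auto simp: R_def)
  have "{..<?L} \<subseteq> \<sigma> ` {..<?L}"
  proof
    fix a assume a: "a \<in> {..<?L}"
    have "(odometer \<alpha> ^^ a) (\<lambda>_. 0) \<in> speedup ` X"
      using speedup_image odometer_power_in_X[OF zero_in_X] by blast
    then obtain x where x: "x \<in> X" "speedup x = (odometer \<alpha> ^^ a) (\<lambda>_. 0)" by force
    then have "\<sigma> (residue m x) = a" using factor[OF x(1)] a by (simp add: residue_odometer_power_zero)
    then show "a \<in> \<sigma> ` {..<?L}" using residue_less[OF x(1)] by blast
  qed
  then have inj: "inj_on \<sigma> {..<?L}" by (intro finite_surj_inj) auto
  have R_fwd: "\<sigma> ` R \<subseteq> R"
  proof -
    have "\<sigma> (walk step k mod ?L) = walk step (Suc k) mod ?L" for k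
      using factor[OF pow_X, of k] unfolding res_walk by simp
    then show ?thesis unfolding R_def by blast
  qed
  have R_onto: "\<sigma> ` R = R"
    using endo_inj_surj[OF finite_subset[OF R_sub] R_fwd inj_on_subset[OF inj R_sub]] by simp
  define A where "A = {x \<in> X. residue m x \<in> R}"
  have inv: "speedup y \<in> A \<longleftrightarrow> y \<in> A" if y: "y \<in> X" for y
  proof -
    have "\<sigma> (residue m y) \<in> R \<longleftrightarrow> residue m y \<in> R"
      using inj_on_image_mem_iff[OF inj _ R_sub] residue_less[OF y] R_onto by auto
    then show ?thesis using y speedup_image factor[OF y] by (auto simp: A_def)
  qed
  have zero_A: "(\<lambda>_. 0) \<in> A"
  proof -
    have "walk step 0 mod ?L \<in> R" unfolding R_def by (rule rangeI)
    then show ?thesis by (simp add: A_def zero_in_X residue_zero)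
  qed
  let ?V = "{y \<in> X. residue m y = b mod ?L}"
  have "(odometer \<alpha> ^^ b) (\<lambda>_. 0) \<in> ?V"
    by (simp add: residue_odometer_power_zero odometer_power_in_X zero_in_X)
  then obtain y where y: "y \<in> range (\<lambda>n. int_iterate X speedup n (\<lambda>_. 0))" "y \<in> ?V"
    using speedup_dense[OF zero_in_X] openin_cylinder[of m "b mod ?L"]
    by (smt (verit) in_closure_of mem_Collect_eq)
  moreover have "A \<subseteq> X" by (simp add: A_def)
  ultimately have "y \<in> A" using int_iterate_invariant[OF _ zero_A inv] by blast
  then have "b mod ?L \<in> R" using y(2) by (simp add: A_def)
  then show ?thesis by (auto simp: R_def cong_def)
qed

end


section \<open>Rigidity\<close>

theorem theorem3p9:
  fixes \<alpha> :: "nat \<Rightarrow> nat" and p :: "(nat \<Rightarrow> nat) \<Rightarrow> nat"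
  assumes "\<And>i. \<alpha> i \<ge> 2"
    and "\<And>q :: nat. prime q \<Longrightarrow> infinite {i. q dvd \<alpha> i}"
    and "\<And>x. x \<in> topspace (odometer_space \<alpha>) \<Longrightarrow> p x > 0"
    and "\<exists>B. \<forall>x \<in> topspace (odometer_space \<alpha>). p x \<le> B"
    and "minimal_homeomorphism (odometer_space \<alpha>) (\<lambda>x. (odometer \<alpha> ^^ p x) x)"
  shows "\<forall>x \<in> topspace (odometer_space \<alpha>). p x = 1"
proof -
  interpret minimal_speedup \<alpha> p
    by unfold_locales (use assms in auto)
  obtain n where n: "\<And>x y. x \<in> X \<Longrightarrow> y \<in> X \<Longrightarrow> residue n x = residue n y \<Longrightarrow> p x = p y"
    using locally_constant_factors[OF p_locally_constant] by blast
  have orbit: "(odometer \<alpha> ^^ a) (\<lambda>_. 0) \<in> X" for a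
    by (rule odometer_power_in_X[OF zero_in_X])
  have step1: "step a = 1" for a
  proof (rule walk_unit_steps[of "modulus n" step, OF modulus_pos])
    show "step (a mod modulus n) = step a" for a
      unfolding step_def by (rule n) (simp_all add: orbit residue_odometer_power_zero)
    show "step a > 0" for a
      unfolding step_def using assms(3) orbit by blast
    fix q :: nat assume "prime q"
    then obtain i where i: "n \<le> i" "q dvd \<alpha> i"
      using assms(2) unfolding infinite_nat_iff_unbounded_le by blast
    have "\<alpha> i dvd (\<Prod>j=n..<Suc i. \<alpha> j)"
      using i(1) by (intro dvd_prodI) simp_all
    with i(2) have "q dvd (\<Prod>j=n..<Suc i. \<alpha> j)" by (rule dvd_trans)
    moreover have "\<exists>k. [walk step k = b] (mod modulus n * (\<Prod>j=n..<Suc i. \<alpha> j))" for b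
      unfolding modulus_split[OF le_SucI[OF i(1)], symmetric]
      by (rule walk_hits_residue[OF n le_SucI[OF i(1)]])
    ultimately show "\<exists>M. q dvd M \<and> (\<forall>b. \<exists>k. [walk step k = b] (mod modulus n * M))" by blast
  qed
  show ?thesis
  proof
    fix x assume x: "x \<in> X"
    have "residue n ((odometer \<alpha> ^^ residue n x) (\<lambda>_. 0)) = residue n x"
      using residue_less[OF x] by (simp add: residue_odometer_power_zero)
    then have "p x = step (residue n x)" unfolding step_def by (metis n x orbit)
    then show "p x = 1" using step1 by simp
  qed
qed

end
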